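(* Let $G$ be a locally compact abelian group, $\gamma\in\Gamma$, $s\ge0$, and assume that the function $\xi\mapsto (1+\gamma(\xi)^2)^{-s}$ belongs to $L^1(G^\wedge,\mu_{G^\wedge})$. Then $H^s_\gamma(G)\hookrightarrow C(G)$: there is a constant $C(\gamma,s)$ such that every $f\in H^s_\gamma(G)$ coincides $\mu_G$-almost everywhere with a continuous function on $G$, and this continuous function satisfies \[ \sup_{x\in G}|f(x)|\le C(\gamma,s)\,\|f\|_{H^s_\gamma(G)}. \]
   Context: $C(G)$ denotes the continuous complex-valued functions on $G$, with $\|f\|_{C(G)}=\sup_{x\in G}|f(x)|$. $G$ is a locally compact abelian group with Haar measure $\mu_G$; $G^\wedge$ is its dual group (continuous homomorphisms $G\to\{z\in\mathbb C:|z|=1\}$, a locally compact abelian group under pointwise multiplication) with Haar measure $\mu_{G^\wedge}$ normalized so that the Plancherel theorem and Fourier inversion hold. For $f\in L^1_{\mu_G}(G)$, $\hat f(\xi)=\int_G\overline{\xi(x)}f(x)\,d\mu_G(x)$, extended to $L^2$ by Plancherel. $\Gamma$ is the set of functions $\gamma:G^\wedge\to[0,\infty)$ for which there is a constant $c_\gamma$ with $\gamma(\alpha\beta)\le c_\gamma[\gamma(\alpha)+\gamma(\beta)]$ for all $\alpha,\beta\in G^\wedge$. For $\gamma\in\Gamma$ and real $s\ge0$, $H^s_\gamma(G)$ is the set of $f\in L^2_{\mu_G}(G)$ with $\|f\|_{H^s_\gamma(G)}=\left(\int_{G^\wedge}(1+\gamma(\xi)^2)^s|\hat f(\xi)|^2\,d\mu_{G^\wedge}(\xi)\right)^{1/2}<\infty$.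 *)

theory Defs
  imports "HOL-Analysis.Analysis"
begin

definition locally_compact_group :: "'a::{topological_ab_group_add,t2_space} itself \<Rightarrow> bool" where
  "locally_compact_group T \<longleftrightarrow>
     (\<forall>x::'a. \<exists>U K. open U \<and> compact K \<and> x \<in> U \<and> U \<subseteq> K)"

definition borel_of_top :: "'a topology \<Rightarrow> 'a measure" where
  "borel_of_top X = sigma (topspace X) {U. openin X U}"

definition haar_measure :: "'a topology \<Rightarrow> ('a \<Rightarrow> 'a \<Rightarrow> 'a) \<Rightarrow> 'a measure \<Rightarrow> bool" where
  "haar_measure X op M \<longleftrightarrow>
     space M = topspace X \<and> sets M = sets (borel_of_top X) \<and>
     (\<forall>A\<in>sets M. \<forall>x\<in>topspace X. emeasure M (op x ` A) = emeasure M A) \<and>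
     (\<forall>K. compactin X K \<longrightarrow> emeasure M K < \<infinity>) \<and>
     (\<forall>A\<in>sets M. emeasure M A = (INF U\<in>{U. openin X U \<and> A \<subseteq> U}. emeasure M U)) \<and>
     (\<forall>U. openin X U \<longrightarrow> emeasure M U = (SUP K\<in>{K. compactin X K \<and> K \<subseteq> U}. emeasure M K)) \<and>
     emeasure M (topspace X) \<noteq> 0"

definition dual_group :: "('a::{topological_ab_group_add,t2_space} \<Rightarrow> complex) set" where
  "dual_group = {psi. continuous_on UNIV psi \<and> (\<forall>x y. psi (x + y) = psi x * psi y) \<and>
                     (\<forall>x. cmod (psi x) = 1)}"

definition dual_mult :: "('a \<Rightarrow> complex) \<Rightarrow> ('a \<Rightarrow> complex) \<Rightarrow> ('a \<Rightarrow> complex)" where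
  "dual_mult \<alpha> \<beta> = (\<lambda>x. \<alpha> x * \<beta> x)"

text \<open>Compact-open topology on the dual group (uniform convergence on compacta).\<close>
definition dual_topology :: "('a::{topological_ab_group_add,t2_space} \<Rightarrow> complex) topology" where
  "dual_topology = topology_generated_by
     {{psi\<in>dual_group. \<forall>x\<in>K. dist (psi x) (psi0 x) < e} | K psi0 e.
        compact K \<and> psi0 \<in> dual_group \<and> e > 0}"

definition fourier :: "'a measure \<Rightarrow> ('a \<Rightarrow> complex) \<Rightarrow> ('a \<Rightarrow> complex) \<Rightarrow> complex" where
  "fourier MG f \<xi> = (LINT x|MG. cnj (\<xi> x) * f x)"

definition square_integrable :: "'a measure \<Rightarrow> ('a \<Rightarrow> complex) \<Rightarrow> bool" where
  "square_integrable M f \<longleftrightarrow> f \<in> borel_measurable M \<and> integrable M (\<lambda>x. (cmod (f x))\<^sup>2)"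

definition plancherel_normalized :: "'a measure \<Rightarrow> ('a \<Rightarrow> complex) measure \<Rightarrow> bool" where
  "plancherel_normalized MG MD \<longleftrightarrow>
     (\<forall>f. integrable MG f \<and> square_integrable MG f \<longrightarrow>
        (\<integral>\<^sup>+\<xi>. ennreal ((cmod (fourier MG f \<xi>))\<^sup>2) \<partial>MD) = (\<integral>\<^sup>+x. ennreal ((cmod (f x))\<^sup>2) \<partial>MG))"

text \<open>g is (a representative of) the Plancherel Fourier transform of f \<in> L^2:
  the L^2-limit of Fourier transforms of L^1 \<inter> L^2 approximants of f.\<close>
definition plancherel_transform ::
  "'a measure \<Rightarrow> ('a \<Rightarrow> complex) measure \<Rightarrow> ('a \<Rightarrow> complex) \<Rightarrow> (('a \<Rightarrow> complex) \<Rightarrow> complex) \<Rightarrow> bool" where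
  "plancherel_transform MG MD f g \<longleftrightarrow>
     square_integrable MD g \<and>
     (\<exists>fs. (\<forall>n. integrable MG (fs n) \<and> square_integrable MG (fs n)) \<and>
        (\<lambda>n. LINT x|MG. (cmod (fs n x - f x))\<^sup>2) \<longlonglongrightarrow> 0 \<and>
        (\<lambda>n. LINT \<xi>|MD. (cmod (fourier MG (fs n) \<xi> - g \<xi>))\<^sup>2) \<longlonglongrightarrow> 0)"

definition Gamma_class :: "(('a::{topological_ab_group_add,t2_space} \<Rightarrow> complex) \<Rightarrow> real) set" where
  "Gamma_class = {\<gamma>. (\<forall>\<xi>\<in>dual_group. \<gamma> \<xi> \<ge> 0) \<and>
     (\<exists>c. \<forall>\<alpha>\<in>dual_group. \<forall>\<beta>\<in>dual_group. \<gamma> (dual_mult \<alpha> \<beta>) \<le> c * (\<gamma> \<alpha> + \<gamma> \<beta>))}"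

text \<open>Squared H^s_\<gamma> norm, expressed through the Fourier transform g of f.\<close>
definition Hs_norm_sq :: "('b measure) \<Rightarrow> ('b \<Rightarrow> real) \<Rightarrow> real \<Rightarrow> ('b \<Rightarrow> complex) \<Rightarrow> ennreal" where
  "Hs_norm_sq MD \<gamma> s g = (\<integral>\<^sup>+\<xi>. ennreal ((1 + (\<gamma> \<xi>)\<^sup>2) powr s * (cmod (g \<xi>))\<^sup>2) \<partial>MD)"

end

theory Submission
  imports Defs
begin

text \<open>Writing \<open>w = 1 + \<gamma>\<^sup>2\<close>, Cauchy--Schwarz applied to \<open>g = w\<^bsup>-s/2\<^esup> (w\<^bsup>s/2\<^esup> g)\<close> bounds the \<open>L\<^sup>1\<close> norm
  of the Plancherel transform \<open>g\<close> of \<open>f\<close> by the Sobolev norm, so \<open>h x = \<integral> g \<xi> * \<xi> x\<close> is continuous and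
  bounded as required. That \<open>f = h\<close> needs only the Plancherel isometry, not Fourier inversion: for
  a Borel subset \<open>A\<close> of a compact set with indicator \<open>\<chi>\<close>, polarization gives \<open>\<integral> f \<chi> = \<integral> g cnj (fourier \<chi>)\<close>, and
  exchanging integrals turns the right-hand side into \<open>\<integral> h \<chi>\<close>. Hence \<open>f = h\<close> locally almost everywhere.\<close>

subsection \<open>Regularity of Haar measures\<close>

text \<open>Without integrability of \<open>f\<close> its integral is 0 by convention, and the
  right-hand side is nonnegative because \<open>g\<close> dominates a norm; so the later estimates
  only have to check the majorant.\<close>

lemma norm_integral_le:
  fixes f :: "'a \<Rightarrow> 'b::{banach,second_countable_topology}"
  assumes "integrable M g" "\<And>x. x \<in> space M \<Longrightarrow> norm (f x) \<le> g x"
  shows "norm (\<integral>x. f x \<partial>M) \<le> (\<integral>x. g x \<partial>M)"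
proof (cases "integrable M f")
  case True
  have "norm (\<integral>x. f x \<partial>M) \<le> (\<integral>x. norm (f x) \<partial>M)" by (rule integral_norm_bound)
  also have "\<dots> \<le> (\<integral>x. g x \<partial>M)"
    using assms True by (intro integral_mono) auto
  finally show ?thesis .
next
  case False
  have "0 \<le> (\<integral>x. g x \<partial>M)"
    using assms(2) norm_ge_zero order_trans by (intro Bochner_Integration.integral_nonneg) blast
  then show ?thesis using False by (simp add: not_integrable_integral_eq)
qed

lemma openin_in_sets:
  assumes "haar_measure X op M" "openin X U"
  shows "U \<in> sets M"
  using assms openin_subset unfolding haar_measure_def borel_of_top_def
  by (metis (mono_tags, lifting) in_measure_of mem_Collect_eq PowI subsetI)

text \<open>Inner regularity is given on open sets, so \<open>A\<close> is first enclosed in an open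
  \<open>U\<close> of finite measure by outer regularity; compact subsets whose measures approach
  that of \<open>U\<close> then exhaust \<open>U\<close> up to a null set.\<close>

lemma finite_measure_sigma_compact:
  assumes H: "haar_measure X op M" and A: "A \<in> sets M" "emeasure M A < \<infinity>"
  obtains K :: "nat \<Rightarrow> 'a set" where "\<And>n. compactin X (K n)" "\<And>n. K n \<in> sets M"
    "A - (\<Union>n. K n) \<in> null_sets M"
proof -
  have "(INF U\<in>{U. openin X U \<and> A \<subseteq> U}. emeasure M U) < \<infinity>"
    using H A unfolding haar_measure_def by metis
  then obtain U where U: "openin X U" "A \<subseteq> U" "emeasure M U < \<infinity>"
    by (auto simp: INF_less_iff)
  have UM: "U \<in> sets M" using openin_in_sets[OF H U(1)] .
  let ?C = "{K. compactin X K \<and> K \<subseteq> U}"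
  have ne: "?C \<noteq> {}" by (auto intro: exI[of _ "{}"])
  obtain k :: "nat \<Rightarrow> ennreal" where k: "range k \<subseteq> emeasure M ` ?C"
    "Sup (emeasure M ` ?C) = Sup (range k)"
    using ennreal_SUP_countable_SUP[OF ne, of "emeasure M"] by auto
  have "\<forall>n. \<exists>K. K \<in> ?C \<and> K \<in> sets M \<and> emeasure M K = k n"
  proof
    fix n
    obtain K where K: "K \<in> ?C" "emeasure M K = k n" using k(1) by (metis (no_types, lifting) imageE rangeI subsetD)
    \<comment> \<open>A compact set need not be Borel in a general \<open>X\<close>; outside
      \<open>sets M\<close> the measure defaults to 0, a value the empty set attains as
      well.\<close>
    show "\<exists>K. K \<in> ?C \<and> K \<in> sets M \<and> emeasure M K = k n"
    proof (cases "K \<in> sets M")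
      case False
      then have "k n = 0" using K emeasure_notin_sets by metis
      then show ?thesis by (intro exI[of _ "{}"]) auto
    qed (use K in auto)
  qed
  then obtain K where K: "\<And>n. K n \<in> ?C" "\<And>n. K n \<in> sets M" "\<And>n. emeasure M (K n) = k n"
    by metis
  have "emeasure M U = Sup (range k)"
    using H U(1) k(2) unfolding haar_measure_def by metis
  also have "\<dots> \<le> emeasure M (\<Union>n. K n)"
    unfolding SUP_le_iff using K(2) by (auto simp: K(3)[symmetric] intro!: emeasure_mono Sup_least)
  \<comment> \<open>Finiteness of \<open>emeasure M U\<close> is what permits the
    subtraction.\<close>
  finally have "emeasure M (U - (\<Union>n. K n)) = 0"
    using K U UM by (subst emeasure_Diff) (auto simp: top.not_eq_extremum intro!: diff_eq_0_ennreal
      intro: le_less_trans[OF emeasure_mono[of _ U M]])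
  then have "U - (\<Union>n. K n) \<in> null_sets M" using UM K by (auto simp: null_sets_def)
  then have "A - (\<Union>n. K n) \<in> null_sets M"
    by (rule null_sets_subset) (use A K U in auto)
  then show ?thesis using that[of K] K by auto
qed

text \<open>The sets where \<open>norm (u x)\<close> is at least \<open>1 / (n + 1)\<close> have
  finite measure by Markov's inequality and exhaust the support.\<close>

lemma integrable_support_sigma_finite:
  fixes u :: "'a \<Rightarrow> 'b::{banach,second_countable_topology}"
  assumes "integrable M u"
  obtains A :: "nat \<Rightarrow> 'a set" where "\<And>n. A n \<in> sets M" "\<And>n. emeasure M (A n) < \<infinity>"
    "{x \<in> space M. u x \<noteq> 0} = (\<Union>n. A n)"
proof -
  define A where "A n = {x \<in> space M. norm (u x) \<ge> 1 / real (Suc n)}" for n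
  note [measurable] = borel_measurable_integrable[OF assms]
  have "A n \<in> sets M" for n unfolding A_def by measurable
  moreover have "emeasure M (A n) < \<infinity>" for n
  proof -
    have "emeasure M (A n) \<le> ennreal (1 / (1 / real (Suc n)) * (\<integral>x. norm (u x) \<partial>M))"
      unfolding A_def by (rule integral_Markov_inequality) (use assms in auto)
    also have "\<dots> < \<infinity>" by simp
    finally show ?thesis .
  qed
  moreover have "{x \<in> space M. u x \<noteq> 0} = (\<Union>n. A n)"
  proof (intro equalityI subsetI)
    fix x assume x: "x \<in> {x \<in> space M. u x \<noteq> 0}"
    then obtain n where "inverse (real (Suc n)) < norm (u x)"
      using reals_Archimedean[of "norm (u x)"] by auto
    then have "x \<in> A n" using x by (auto simp: A_def inverse_eq_divide)
    then show "x \<in> (\<Union>n. A n)" by auto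
  next
    fix x assume "x \<in> (\<Union>n. A n)"
    then obtain n where "x \<in> space M" "norm (u x) \<ge> 1 / real (Suc n)" by (auto simp: A_def)
    moreover have "1 / real (Suc n) > 0" by simp
    ultimately show "x \<in> {x \<in> space M. u x \<noteq> 0}" by (auto simp del: of_nat_Suc)
  qed
  ultimately show ?thesis using that by blast
qed

text \<open>Up to a null set the support of \<open>u\<close> is covered by countably many compact
  sets; the integrals off their finite unions tend to 0 by dominated convergence.\<close>

lemma integrable_compact_approx:
  fixes u :: "'a \<Rightarrow> 'b::{banach,second_countable_topology}"
  assumes H: "haar_measure X op M" and u: "integrable M u" and e: "e > 0"
  obtains K where "compactin X K" "K \<in> sets M"
    "(\<integral>x. indicator (space M - K) x * norm (u x) \<partial>M) < e"
proof -
  obtain A :: "nat \<Rightarrow> 'a set" where A: "\<And>n. A n \<in> sets M" "\<And>n. emeasure M (A n) < \<infinity>"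
    "{x \<in> space M. u x \<noteq> 0} = (\<Union>n. A n)"
    using integrable_support_sigma_finite[OF u] by metis
  have "\<exists>K :: nat \<Rightarrow> 'a set. (\<forall>m. compactin X (K m) \<and> K m \<in> sets M) \<and> A n - (\<Union>m. K m) \<in> null_sets M" for n
    using finite_measure_sigma_compact[OF H A(1) A(2), of n] by metis
  then obtain K :: "nat \<Rightarrow> nat \<Rightarrow> 'a set" where K: "\<And>n m. compactin X (K n m)" "\<And>n m. K n m \<in> sets M"
    "\<And>n. A n - (\<Union>m. K n m) \<in> null_sets M"
    by metis
  \<comment> \<open>\<open>prod_decode\<close> lists the double family as one sequence;
    \<open>L j\<close> is the union of its first \<open>j\<close> members, hence compact and
    increasing in \<open>j\<close>.\<close>
  define L where "L j = (\<Union>i<j. case_prod K (prod_decode i))" for j :: nat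
  have Lc: "compactin X (L j)" for j
    unfolding L_def by (rule compactin_Union) (auto split: prod.splits simp: K)
  have Lm[measurable]: "L j \<in> sets M" for j
    unfolding L_def by (auto split: prod.splits simp: K intro!: sets.finite_UN)
  note [measurable] = borel_measurable_integrable[OF u]
  have "AE x in M. \<forall>n. x \<notin> A n - (\<Union>m. K n m)"
    unfolding AE_all_countable using AE_not_in[OF K(3)] by blast
  then have ae: "AE x in M. (\<lambda>j. indicator (space M - L j) x * norm (u x)) \<longlonglongrightarrow> 0"
  proof eventually_elim
    case (elim x)
    have "\<forall>\<^sub>F j in sequentially. indicator (space M - L j) x * norm (u x) = 0"
    proof (cases "x \<in> space M \<and> u x \<noteq> 0")
      case True
      then obtain n where "x \<in> A n" using A(3) by auto
      then obtain m where "x \<in> K n m" using elim by auto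
      then have "x \<in> L j" if "j > prod_encode (n,m)" for j
        unfolding L_def using that by (auto intro!: bexI[of _ "prod_encode (n,m)"])
      then show ?thesis
        by (intro eventually_sequentiallyI[of "Suc (prod_encode (n,m))"]) auto
    qed (auto split: split_indicator)
    then show ?case by (rule tendsto_eventually)
  qed
  have "(\<lambda>j. \<integral>x. indicator (space M - L j) x * norm (u x) \<partial>M) \<longlonglongrightarrow> (\<integral>x. 0 \<partial>M)"
    by (rule integral_dominated_convergence[where w = "\<lambda>x. norm (u x)"])
       (use u ae in \<open>auto split: split_indicator\<close>)
  then have "\<forall>\<^sub>F j in sequentially. (\<integral>x. indicator (space M - L j) x * norm (u x) \<partial>M) < e"
    using e order_tendstoD(2) by fastforce
  then obtain j where "(\<integral>x. indicator (space M - L j) x * norm (u x) \<partial>M) < e"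
    using eventually_happens by force
  then show ?thesis using that Lc Lm by blast
qed

subsection \<open>Integration over the dual group\<close>

text \<open>The modulus is measured by uniform distance on \<open>K\<close>, as in the compact-open
  topology. One constant \<open>B\<close> bounds both size and Lipschitz modulus, so that quadrature
  errors are linear in \<open>B\<close>. Evaluations at points of \<open>K\<close> and transforms of
  functions supported in \<open>K\<close> are the intended instances.\<close>

definition dual_lipschitz :: "'a set \<Rightarrow> real \<Rightarrow> (('a::{topological_ab_group_add,t2_space} \<Rightarrow> complex) \<Rightarrow> complex) \<Rightarrow> bool" where
  "dual_lipschitz K B T \<longleftrightarrow> (\<forall>\<xi>\<in>dual_group. cmod (T \<xi>) \<le> B) \<and>
     (\<forall>\<xi>\<in>dual_group. \<forall>\<eta>\<in>dual_group. \<forall>d>0. (\<forall>x\<in>K. dist (\<xi> x) (\<eta> x) < d) \<longrightarrow> dist (T \<xi>) (T \<eta>) \<le> B * d)"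

lemma dual_lipschitzD:
  assumes "dual_lipschitz K B T"
  shows "\<xi> \<in> dual_group \<Longrightarrow> cmod (T \<xi>) \<le> B"
    and "\<xi> \<in> dual_group \<Longrightarrow> \<eta> \<in> dual_group \<Longrightarrow> d > 0 \<Longrightarrow> (\<And>x. x \<in> K \<Longrightarrow> dist (\<xi> x) (\<eta> x) < d)
      \<Longrightarrow> cmod (T \<xi> - T \<eta>) \<le> B * d"
  using assms unfolding dual_lipschitz_def dist_norm by blast+

lemma one_in_dual_group: "(\<lambda>_. 1) \<in> dual_group"
  by (auto simp: dual_group_def)

lemma dual_lipschitz_nonneg: "dual_lipschitz K B T \<Longrightarrow> B \<ge> 0"
  using dual_lipschitzD(1)[OF _ one_in_dual_group] norm_ge_zero order_trans by blast

lemma dual_lipschitz_eval: "x \<in> K \<Longrightarrow> dual_lipschitz K 1 (\<lambda>\<xi>. \<xi> x)"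
  by (auto simp: dual_lipschitz_def dual_group_def less_imp_le)

lemma dual_lipschitz_cnj: "dual_lipschitz K B T \<Longrightarrow> dual_lipschitz K B (\<lambda>\<xi>. cnj (T \<xi>))"
  by (simp add: dual_lipschitz_def dist_norm flip: complex_cnj_diff)

definition dual_nhd :: "'a set \<Rightarrow> real \<Rightarrow> ('a::{topological_ab_group_add,t2_space} \<Rightarrow> complex) \<Rightarrow> ('a \<Rightarrow> complex) set" where
  "dual_nhd K e \<xi> = {\<psi>\<in>dual_group. \<forall>x\<in>K. dist (\<psi> x) (\<xi> x) < e}"

lemma openin_dual_nhd:
  "compact K \<Longrightarrow> \<xi> \<in> dual_group \<Longrightarrow> e > 0 \<Longrightarrow> openin dual_topology (dual_nhd K e \<xi>)"
  unfolding dual_topology_def dual_nhd_def by (rule topology_generated_by_Basis) blast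

lemma dual_nhd_self: "\<xi> \<in> dual_group \<Longrightarrow> e > 0 \<Longrightarrow> \<xi> \<in> dual_nhd K e \<xi>"
  by (auto simp: dual_nhd_def)

lemma topspace_dual_topology: "topspace dual_topology = dual_group"
proof
  show "topspace dual_topology \<subseteq> dual_group"
    by (auto simp: dual_topology_def)
  show "dual_group \<subseteq> topspace dual_topology"
    using openin_subset[OF openin_dual_nhd[OF compact_empty, of _ 1]] dual_nhd_self[of _ 1 "{}"] by force
qed

lemma space_dual: "haar_measure dual_topology op MD \<Longrightarrow> space MD = dual_group"
  by (simp add: haar_measure_def topspace_dual_topology)

lemma sets_haar_euclidean:
  "haar_measure euclidean op M \<Longrightarrow> sets M = sets borel"
  by (simp add: haar_measure_def borel_of_top_def borel_def)

lemma dual_group_measurable: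
  assumes "haar_measure euclidean op MG" "\<xi> \<in> dual_group"
  shows "\<xi> \<in> borel_measurable MG"
  using assms borel_measurable_continuous_onI[of \<xi>] measurable_cong_sets[OF sets_haar_euclidean[OF assms(1)] refl, of borel]
  by (auto simp: dual_group_def)

text \<open>Such a \<open>T\<close> is continuous for the compact-open topology, so preimages of
  open sets are open and therefore measurable.\<close>

lemma dual_lipschitz_measurable:
  assumes H: "haar_measure dual_topology op MD" and K: "compact K" and T: "dual_lipschitz K B T"
  shows "T \<in> borel_measurable MD"
proof (rule borel_measurableI)
  fix S :: "complex set" assume S: "open S"
  have "openin dual_topology (T -` S \<inter> dual_group)"
  proof (subst openin_subopen, intro ballI)
    fix \<xi> assume \<xi>: "\<xi> \<in> T -` S \<inter> dual_group"
    then obtain e where e: "e > 0" "ball (T \<xi>) e \<subseteq> S" using S open_contains_ball by (metis IntD1 vimageE)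
    have B: "B \<ge> 0" using dual_lipschitz_nonneg[OF T] .
    \<comment> \<open>Adding 1 to \<open>B\<close> keeps the quotient meaningful for
      \<open>B = 0\<close> and still gives \<open>B * d < e\<close>.\<close>
    define d where "d = e / (2 * (B + 1))"
    have d: "d > 0" "B * d < e" using e B by (auto simp: d_def field_simps intro: add_nonneg_pos)
    have "dual_nhd K d \<xi> \<subseteq> T -` S \<inter> dual_group"
    proof
      fix \<eta> assume \<eta>: "\<eta> \<in> dual_nhd K d \<xi>"
      then have "cmod (T \<eta> - T \<xi>) \<le> B * d"
        by (intro dual_lipschitzD(2)[OF T]) (use \<xi> d in \<open>auto simp: dual_nhd_def\<close>)
      then have "T \<eta> \<in> ball (T \<xi>) e" using d by (simp add: dist_norm norm_minus_commute)
      then show "\<eta> \<in> T -` S \<inter> dual_group" using e \<eta> by (auto simp: dual_nhd_def)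
    qed
    then show "\<exists>U. openin dual_topology U \<and> \<xi> \<in> U \<and> U \<subseteq> T -` S \<inter> dual_group"
      using openin_dual_nhd[OF K, of \<xi> d] dual_nhd_self[of \<xi> d K] \<xi> d by blast
  qed
  then show "T -` S \<inter> space MD \<in> sets MD"
    using openin_in_sets[OF H] space_dual[OF H] by simp
qed

lemma integrable_mult_dual_lipschitz:
  assumes H: "haar_measure dual_topology op MD" and K: "compact K" and T: "dual_lipschitz K B T"
    and g: "integrable MD g"
  shows "integrable MD (\<lambda>\<zeta>. g \<zeta> * T \<zeta>)"
proof (rule Bochner_Integration.integrable_bound)
  show "integrable MD (\<lambda>\<zeta>. B *\<^sub>R g \<zeta>)" using g by simp
  show "(\<lambda>\<zeta>. g \<zeta> * T \<zeta>) \<in> borel_measurable MD"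
    using g dual_lipschitz_measurable[OF H K T] by measurable
  show "AE \<zeta> in MD. norm (g \<zeta> * T \<zeta>) \<le> norm (B *\<^sub>R g \<zeta>)"
    using dual_lipschitzD(1)[OF T] dual_lipschitz_nonneg[OF T] space_dual[OF H]
    by (auto intro!: AE_I2 mult_left_mono simp: norm_mult mult.commute[of B])
qed

text \<open>Replaces Fubini's theorem, which is not available since the measures need not be
  \<open>\<sigma>\<close>-finite and \<open>(x, \<xi>) \<mapsto> \<xi> x\<close> need not be measurable for the product \<open>\<sigma>\<close>-algebra:
  one and the same finite combination of point evaluations works for all \<open>T\<close>.\<close>
lemma dual_quadrature:
  fixes MD :: "('a::{topological_ab_group_add,t2_space} \<Rightarrow> complex) measure"
  assumes H: "haar_measure dual_topology op MD" and K: "compact K"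
    and g: "integrable MD g" and e: "e > 0"
  obtains N :: nat and \<xi> :: "nat \<Rightarrow> 'a \<Rightarrow> complex" and c :: "nat \<Rightarrow> complex"
  where "\<And>i. i < N \<Longrightarrow> \<xi> i \<in> dual_group"
    "\<And>T B. dual_lipschitz K B T \<Longrightarrow>
       cmod ((\<integral>\<zeta>. g \<zeta> * T \<zeta> \<partial>MD) - (\<Sum>i<N. c i * T (\<xi> i))) \<le> e * B"
proof -
  note sp = space_dual[OF H]
  \<comment> \<open>Outside the compact set \<open>L\<close> of characters \<open>g\<close> has mass
    below \<open>e / 2\<close>; on \<open>L\<close> a finite cover by small neighbourhoods is
    available.\<close>
  obtain L where L: "compactin dual_topology L" and [measurable]: "L \<in> sets MD"
    and Lg: "(\<integral>x. indicator (space MD - L) x * norm (g x) \<partial>MD) < e / 2"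
    using integrable_compact_approx[OF H g, of "e / 2"] e by auto
  define I where "I = (\<integral>x. norm (g x) \<partial>MD)"
  have I: "I \<ge> 0" unfolding I_def by simp
  \<comment> \<open>The aim is \<open>I * d \<le> e / 2\<close>; the summand 1 covers the case
    \<open>I = 0\<close>.\<close>
  define d where "d = e / (2 * (I + 1))"
  have d: "d > 0" "I * d \<le> e / 2" using e I by (auto simp: d_def field_simps)
  have Ld: "L \<subseteq> dual_group" using L compactin_subset_topspace topspace_dual_topology by metis
  have "\<exists>\<F>. finite \<F> \<and> \<F> \<subseteq> dual_nhd K d ` dual_group \<and> L \<subseteq> \<Union>\<F>"
    using openin_dual_nhd[OF K _ d(1)] dual_nhd_self[OF _ d(1)] Ld
    by (intro compactinD[OF L]) blast+
  then obtain \<F> where \<F>: "finite \<F>" "\<F> \<subseteq> dual_nhd K d ` dual_group" "L \<subseteq> \<Union>\<F>"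
    by blast
  obtain F where F: "F \<subseteq> dual_group" "finite F" "L \<subseteq> (\<Union>\<eta>\<in>F. dual_nhd K d \<eta>)"
    using finite_subset_image[OF \<F>(1,2)] \<F>(3) by blast
  obtain \<xi> :: "nat \<Rightarrow> 'a \<Rightarrow> complex" and N where \<xi>: "F = \<xi> ` {..<N}"
    using F(2) by (metis finite_imp_nat_seg_image_inj_on lessThan_def)
  define V where "V i = dual_nhd K d (\<xi> i)" for i
  \<comment> \<open>Disjoint cells: \<open>W i\<close> collects the points of \<open>L\<close> whose
    first neighbourhood in the list is \<open>V i\<close>. The weights \<open>c i\<close> depend on
    \<open>g\<close> and the cells but not on \<open>T\<close>, which yields the uniformity.\<close>
  define W where "W i = L \<inter> (V i - (\<Union>j<i. V j))" for i
  define c where "c i = (\<integral>\<zeta>. indicator (W i) \<zeta> *\<^sub>R g \<zeta> \<partial>MD)" for i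
  have \<xi>d: "\<xi> i \<in> dual_group" if "i < N" for i using that \<xi> F by auto
  have V[measurable]: "V i \<in> sets MD" if "i < N" for i
    unfolding V_def by (intro openin_in_sets[OF H] openin_dual_nhd K \<xi>d that d)
  have W[measurable]: "W i \<in> sets MD" if "i < N" for i
    unfolding W_def using V that by (intro sets.Int sets.Diff sets.finite_UN) auto
  have main: "cmod ((\<integral>\<zeta>. g \<zeta> * T \<zeta> \<partial>MD) - (\<Sum>i<N. c i * T (\<xi> i))) \<le> e * B"
    if T: "dual_lipschitz K B T" for T B
  proof -
    have B: "B \<ge> 0" using dual_lipschitz_nonneg[OF T] .
    have iW: "integrable MD (\<lambda>\<zeta>. indicator (W i) \<zeta> *\<^sub>R g \<zeta> * T (\<xi> i))" if "i < N" for i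
      by (rule integrable_mult_left) (rule integrable_mult_indicator[OF W[OF that] g])
    have "(\<Sum>i<N. c i * T (\<xi> i)) = (\<Sum>i<N. \<integral>\<zeta>. indicator (W i) \<zeta> *\<^sub>R g \<zeta> * T (\<xi> i) \<partial>MD)"
      unfolding c_def by (intro sum.cong refl integral_mult_left_zero[symmetric])
    also have "\<dots> = (\<integral>\<zeta>. (\<Sum>i<N. indicator (W i) \<zeta> *\<^sub>R g \<zeta> * T (\<xi> i)) \<partial>MD)"
      using iW by (subst Bochner_Integration.integral_sum) auto
    finally have eq: "(\<Sum>i<N. c i * T (\<xi> i)) =
        (\<integral>\<zeta>. (\<Sum>i<N. indicator (W i) \<zeta> *\<^sub>R g \<zeta> * T (\<xi> i)) \<partial>MD)" .
    have "(\<integral>\<zeta>. g \<zeta> * T \<zeta> \<partial>MD) - (\<Sum>i<N. c i * T (\<xi> i)) =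
        (\<integral>\<zeta>. g \<zeta> * T \<zeta> - (\<Sum>i<N. indicator (W i) \<zeta> *\<^sub>R g \<zeta> * T (\<xi> i)) \<partial>MD)"
      unfolding eq
      by (intro Bochner_Integration.integral_diff[symmetric] Bochner_Integration.integrable_sum
        iW integrable_mult_dual_lipschitz[OF H K T g]) auto
    \<comment> \<open>The first term of the majorant handles points off \<open>L\<close> through the
      bound on \<open>T\<close>, the second handles points of \<open>L\<close> through the Lipschitz
      estimate between a point and the node of its cell.\<close>
    also have "cmod \<dots> \<le> (\<integral>\<zeta>. B * (indicator (space MD - L) \<zeta> * norm (g \<zeta>)) + (B * d) * norm (g \<zeta>) \<partial>MD)"
    proof (rule norm_integral_le)
      show "integrable MD (\<lambda>\<zeta>. B * (indicator (space MD - L) \<zeta> * norm (g \<zeta>)) + (B * d) * norm (g \<zeta>))"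
        using g integrable_mult_indicator[of "space MD - L" MD "\<lambda>x. norm (g x)"] by auto
      fix \<zeta> assume \<zeta>: "\<zeta> \<in> space MD"
      show "cmod (g \<zeta> * T \<zeta> - (\<Sum>i<N. indicator (W i) \<zeta> *\<^sub>R g \<zeta> * T (\<xi> i)))
        \<le> B * (indicator (space MD - L) \<zeta> * norm (g \<zeta>)) + (B * d) * norm (g \<zeta>)"
      proof (cases "\<zeta> \<in> L")
        case False
        then have "cmod (g \<zeta> * T \<zeta>) \<le> B * norm (g \<zeta>)"
          using dual_lipschitzD(1)[OF T] \<zeta> sp by (simp add: norm_mult mult.commute mult_right_mono)
        then have "cmod (g \<zeta> * T \<zeta>) \<le> B * norm (g \<zeta>) + (B * d) * norm (g \<zeta>)" using B d by (simp add: add_increasing2)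
        then show ?thesis using False \<zeta> by (simp add: W_def)
      next
        case True
        \<comment> \<open>\<open>i0\<close> indexes the one cell containing \<open>\<zeta>\<close>,
          so the sum over cells collapses to a single term.\<close>
        define i0 where "i0 = (LEAST i. \<zeta> \<in> V i)"
        obtain i1 where i1: "i1 < N" "\<zeta> \<in> V i1" using True F \<xi> by (auto simp: V_def)
        have i0: "\<zeta> \<in> V i0" "i0 \<le> i1" unfolding i0_def using i1 by (auto intro: LeastI Least_le)
        have m: "i0 \<le> i" if "\<zeta> \<in> V i" for i unfolding i0_def using that by (rule Least_le)
        have "indicator (W i) \<zeta> = (if i = i0 then 1 else 0 :: real)" for i
          using i0 m True by (force simp: W_def indicator_def)
        then have s: "(\<Sum>i<N. indicator (W i) \<zeta> *\<^sub>R g \<zeta> * T (\<xi> i)) = (\<Sum>i<N. if i = i0 then g \<zeta> * T (\<xi> i) else 0)"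
          by (intro sum.cong) auto
        have "cmod (T \<zeta> - T (\<xi> i0)) \<le> B * d"
          using i0 i1 \<zeta> sp \<xi>d[of i0] d
          by (intro dual_lipschitzD(2)[OF T]) (auto simp: V_def dual_nhd_def)
        then have "cmod (g \<zeta>) * cmod (T \<zeta> - T (\<xi> i0)) \<le> cmod (g \<zeta>) * (B * d)"
          by (intro mult_left_mono) auto
        then have "cmod (g \<zeta> * T \<zeta> - g \<zeta> * T (\<xi> i0)) \<le> (B * d) * cmod (g \<zeta>)"
          unfolding right_diff_distrib[symmetric] norm_mult by (simp add: mult.commute)
        then show ?thesis
          unfolding s using i0 i1 True by simp
      qed
    qed
    also have "\<dots> = B * (\<integral>x. indicator (space MD - L) x * norm (g x) \<partial>MD) + B * d * I"
      unfolding I_def using g integrable_mult_indicator[of "space MD - L" MD "\<lambda>x. norm (g x)"]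
      by (subst Bochner_Integration.integral_add) auto
    also have "\<dots> \<le> B * (e / 2) + B * (e / 2)"
      using Lg d B by (intro add_mono) (auto simp: mult.assoc mult.commute[of d] intro!: mult_left_mono)
    finally show ?thesis by (simp add: mult.commute)
  qed
  show ?thesis by (rule that[OF \<xi>d main])
qed

subsection \<open>Square-integrable functions\<close>

lemma borel_measurable_cnj:
  "f \<in> borel_measurable M \<Longrightarrow> (\<lambda>x. cnj (f x)) \<in> borel_measurable M"
  by (rule measurable_compose[OF _ borel_measurable_continuous_onI]) (auto intro: continuous_intros)

text \<open>The scalar is built in because polarization uses \<open>c\<close> equal to 1, -1,
  \<open>\<i>\<close> and \<open>-\<i>\<close>; the pointwise bound is
  \<open>(a + b)^2 \<le> 2 a^2 + 2 b^2\<close>.\<close>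

lemma square_integrable_add_cmult:
  assumes "square_integrable M u" "square_integrable M v"
  shows "square_integrable M (\<lambda>x. u x + c * v x)"
proof -
  have [measurable]: "u \<in> borel_measurable M" "v \<in> borel_measurable M"
    using assms by (auto simp: square_integrable_def)
  have "integrable M (\<lambda>x. (cmod (u x + c * v x))\<^sup>2)"
  proof (rule Bochner_Integration.integrable_bound)
    show "integrable M (\<lambda>x. 2 * (cmod (u x))\<^sup>2 + (2 * (cmod c)\<^sup>2) * (cmod (v x))\<^sup>2)"
      using assms by (auto simp: square_integrable_def)
    show "AE x in M. norm ((cmod (u x + c * v x))\<^sup>2) \<le> norm (2 * (cmod (u x))\<^sup>2 + (2 * (cmod c)\<^sup>2) * (cmod (v x))\<^sup>2)"
    proof (rule AE_I2)
      fix x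
      have "(cmod (u x + c * v x))\<^sup>2 \<le> (cmod (u x) + cmod (c * v x))\<^sup>2"
        by (intro power_mono norm_triangle_ineq) auto
      also have "\<dots> \<le> 2 * (cmod (u x))\<^sup>2 + 2 * (cmod (c * v x))\<^sup>2"
        using sum_squares_bound[of "cmod (u x)" "cmod (c * v x)"] by (simp add: power2_sum)
      finally show "norm ((cmod (u x + c * v x))\<^sup>2) \<le> norm (2 * (cmod (u x))\<^sup>2 + (2 * (cmod c)\<^sup>2) * (cmod (v x))\<^sup>2)"
        by (simp add: norm_mult power_mult_distrib)
    qed
  qed measurable
  then show ?thesis by (auto simp: square_integrable_def)
qed

lemma square_integrable_diff:
  "square_integrable M u \<Longrightarrow> square_integrable M v \<Longrightarrow> square_integrable M (\<lambda>x. u x - v x)"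
  using square_integrable_add_cmult[of M u v "-1"] by simp

text \<open>The inequality for nonnegative integrals is transferred to real ones:
  \<open>2 |u v| \<le> |u|^2 + |v|^2\<close> first makes the product integrable, so every integral
  involved is finite.\<close>

lemma L2_Cauchy_Schwarz:
  assumes "square_integrable M u" "square_integrable M v"
  shows "integrable M (\<lambda>x. u x * v x)"
    and "cmod (\<integral>x. u x * v x \<partial>M) \<le> sqrt (\<integral>x. (cmod (u x))\<^sup>2 \<partial>M) * sqrt (\<integral>x. (cmod (v x))\<^sup>2 \<partial>M)"
    and "(\<integral>x. cmod (u x * v x) \<partial>M) \<le> sqrt (\<integral>x. (cmod (u x))\<^sup>2 \<partial>M) * sqrt (\<integral>x. (cmod (v x))\<^sup>2 \<partial>M)"
proof -
  have [measurable]: "u \<in> borel_measurable M" "v \<in> borel_measurable M"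
    and i: "integrable M (\<lambda>x. (cmod (u x))\<^sup>2)" "integrable M (\<lambda>x. (cmod (v x))\<^sup>2)"
    using assms by (auto simp: square_integrable_def)
  show int: "integrable M (\<lambda>x. u x * v x)"
  proof (rule Bochner_Integration.integrable_bound)
    show "integrable M (\<lambda>x. (cmod (u x))\<^sup>2 + (cmod (v x))\<^sup>2)" using i by simp
    show "AE x in M. norm (u x * v x) \<le> norm ((cmod (u x))\<^sup>2 + (cmod (v x))\<^sup>2)"
    proof (rule AE_I2)
      fix x
      have "2 * (cmod (u x) * cmod (v x)) \<le> (cmod (u x))\<^sup>2 + (cmod (v x))\<^sup>2"
        using sum_squares_bound[of "cmod (u x)" "cmod (v x)"] by simp
      moreover have "0 \<le> cmod (u x) * cmod (v x)" by simp
      ultimately show "norm (u x * v x) \<le> norm ((cmod (u x))\<^sup>2 + (cmod (v x))\<^sup>2)"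
        unfolding norm_mult real_norm_def by linarith
    qed
  qed measurable
  let ?I = "\<integral>x. cmod (u x * v x) \<partial>M" and ?U = "\<integral>x. (cmod (u x))\<^sup>2 \<partial>M" and ?V = "\<integral>x. (cmod (v x))\<^sup>2 \<partial>M"
  have "(\<integral>\<^sup>+x. ennreal (cmod (u x)) * ennreal (cmod (v x)) \<partial>M)\<^sup>2
      \<le> (\<integral>\<^sup>+x. (ennreal (cmod (u x)))\<^sup>2 \<partial>M) * (\<integral>\<^sup>+x. (ennreal (cmod (v x)))\<^sup>2 \<partial>M)"
    by (rule Cauchy_Schwarz_nn_integral) measurable
  moreover have "(\<integral>\<^sup>+x. ennreal (cmod (u x)) * ennreal (cmod (v x)) \<partial>M) = ennreal ?I"
    unfolding ennreal_mult[symmetric, OF norm_ge_zero norm_ge_zero] norm_mult[symmetric]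
    by (intro nn_integral_eq_integral integrable_norm int AE_I2 norm_ge_zero)
  moreover have "(\<integral>\<^sup>+x. (ennreal (cmod (u x)))\<^sup>2 \<partial>M) = ennreal ?U" "(\<integral>\<^sup>+x. (ennreal (cmod (v x)))\<^sup>2 \<partial>M) = ennreal ?V"
    using i by (simp_all add: nn_integral_eq_integral ennreal_power)
  ultimately have "(ennreal ?I)\<^sup>2 \<le> ennreal ?U * ennreal ?V" by simp
  then have "?I\<^sup>2 \<le> ?U * ?V" by (simp add: ennreal_power flip: ennreal_mult)
  then have "?I \<le> sqrt (?U * ?V)" by (rule real_le_rsqrt)
  then show *: "?I \<le> sqrt ?U * sqrt ?V" by (simp add: real_sqrt_mult)
  show "cmod (\<integral>x. u x * v x \<partial>M) \<le> sqrt ?U * sqrt ?V"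
    using integral_norm_bound[of M "\<lambda>x. u x * v x"] * by linarith
qed

lemma square_integrable_cnj: "square_integrable M u \<Longrightarrow> square_integrable M (\<lambda>x. cnj (u x))"
  by (auto simp: square_integrable_def intro: borel_measurable_cnj)

text \<open>Cauchy--Schwarz bounds the difference of the integrals by the \<open>L^2\<close>
  distance of \<open>u n\<close> and \<open>w\<close> times the norm of \<open>v\<close>.\<close>

lemma L2_inner_tendsto:
  assumes u: "\<And>n. square_integrable M (u n)" "square_integrable M w" and v: "square_integrable M v"
    and lim: "(\<lambda>n. \<integral>x. (cmod (u n x - w x))\<^sup>2 \<partial>M) \<longlonglongrightarrow> 0"
  shows "(\<lambda>n. \<integral>x. u n x * cnj (v x) \<partial>M) \<longlonglongrightarrow> (\<integral>x. w x * cnj (v x) \<partial>M)"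
proof (rule LIM_zero_cancel)
  let ?b = "\<lambda>n. sqrt (\<integral>x. (cmod (u n x - w x))\<^sup>2 \<partial>M) * sqrt (\<integral>x. (cmod (cnj (v x)))\<^sup>2 \<partial>M)"
  have "(\<integral>x. u n x * cnj (v x) \<partial>M) - (\<integral>x. w x * cnj (v x) \<partial>M) = (\<integral>x. (u n x - w x) * cnj (v x) \<partial>M)" for n
    using L2_Cauchy_Schwarz(1)[OF u(1) square_integrable_cnj[OF v], of n]
      L2_Cauchy_Schwarz(1)[OF u(2) square_integrable_cnj[OF v]]
    by (simp add: left_diff_distrib)
  then have "cmod ((\<integral>x. u n x * cnj (v x) \<partial>M) - (\<integral>x. w x * cnj (v x) \<partial>M)) \<le> ?b n" for n
    using L2_Cauchy_Schwarz(2)[OF square_integrable_diff[OF u(1) u(2)] square_integrable_cnj[OF v], of n] by simp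
  moreover have "?b \<longlonglongrightarrow> 0"
    using tendsto_mult_left_zero[OF tendsto_real_sqrt[OF lim, simplified]] by simp
  ultimately show "(\<lambda>n. (\<integral>x. u n x * cnj (v x) \<partial>M) - (\<integral>x. w x * cnj (v x) \<partial>M)) \<longlonglongrightarrow> 0"
    by (rule Lim_null_comparison[OF always_eventually[OF allI]])
qed

text \<open>Expresses an inner product through squared norms, the quantities that
  \<open>plancherel_normalized\<close> controls. The factors \<open>1 *\<close> and
  \<open>(-1) *\<close> are kept so that all four terms are instances of
  \<open>u x + c * v x\<close>.\<close>

lemma polarization:
  assumes u: "square_integrable M u" and v: "square_integrable M v"
  shows "4 * (\<integral>x. u x * cnj (v x) \<partial>M) =
    of_real (\<integral>x. (cmod (u x + 1 * v x))\<^sup>2 \<partial>M) - of_real (\<integral>x. (cmod (u x + (-1) * v x))\<^sup>2 \<partial>M)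
    + \<i> * of_real (\<integral>x. (cmod (u x + \<i> * v x))\<^sup>2 \<partial>M) - \<i> * of_real (\<integral>x. (cmod (u x + (-\<i>) * v x))\<^sup>2 \<partial>M)"
proof -
  have i: "integrable M (\<lambda>x. complex_of_real ((cmod (u x + c * v x))\<^sup>2))" for c
    using square_integrable_add_cmult[OF u v, of c] unfolding square_integrable_def
    by (intro integrable_of_real) auto
  have "4 * (u x * cnj (v x)) = of_real ((cmod (u x + 1 * v x))\<^sup>2) - of_real ((cmod (u x + (-1) * v x))\<^sup>2)
    + \<i> * of_real ((cmod (u x + \<i> * v x))\<^sup>2) - \<i> * of_real ((cmod (u x + (-\<i>) * v x))\<^sup>2)" for x
    unfolding complex_norm_square of_real_power[symmetric] by (simp add: algebra_simps)
  then have "(\<integral>x. 4 * (u x * cnj (v x)) \<partial>M) = (\<integral>x. of_real ((cmod (u x + 1 * v x))\<^sup>2) - of_real ((cmod (u x + (-1) * v x))\<^sup>2)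
    + \<i> * of_real ((cmod (u x + \<i> * v x))\<^sup>2) - \<i> * of_real ((cmod (u x + (-\<i>) * v x))\<^sup>2) \<partial>M)"
    by (simp only:)
  also have "\<dots> = (\<integral>x. of_real ((cmod (u x + 1 * v x))\<^sup>2) \<partial>M) - (\<integral>x. of_real ((cmod (u x + (-1) * v x))\<^sup>2) \<partial>M)
    + \<i> * (\<integral>x. of_real ((cmod (u x + \<i> * v x))\<^sup>2) \<partial>M) - \<i> * (\<integral>x. of_real ((cmod (u x + (-\<i>) * v x))\<^sup>2) \<partial>M)"
    by (simp only: Bochner_Integration.integral_add Bochner_Integration.integral_diff
      Bochner_Integration.integrable_add Bochner_Integration.integrable_diff
      i integrable_mult_right integral_mult_right_zero)
  finally show ?thesis by (simp only: integral_complex_of_real integral_mult_right_zero)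
qed

subsection \<open>Fourier transform and Plancherel isometry\<close>

lemma integrable_fourier_integrand:
  assumes "haar_measure euclidean op MG" "integrable MG u" "\<xi> \<in> dual_group"
  shows "integrable MG (\<lambda>x. cnj (\<xi> x) * u x)"
proof (rule Bochner_Integration.integrable_bound[OF assms(2)])
  show "(\<lambda>x. cnj (\<xi> x) * u x) \<in> borel_measurable MG"
    by (intro borel_measurable_times borel_measurable_cnj dual_group_measurable[OF assms(1)]
      borel_measurable_integrable assms)
qed (use assms(3) in \<open>auto simp: dual_group_def norm_mult\<close>)

text \<open>Since characters have modulus 1 and \<open>u\<close> lives on \<open>K\<close>, its
  \<open>L^1\<close> norm works both as bound and as Lipschitz constant.\<close>

lemma dual_lipschitz_fourier:
  assumes H: "haar_measure euclidean op MG" and u: "integrable MG u"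
    and K: "\<And>x. x \<notin> K \<Longrightarrow> u x = 0"
  shows "dual_lipschitz K (\<integral>x. norm (u x) \<partial>MG) (fourier MG u)"
  unfolding dual_lipschitz_def
proof (intro conjI ballI allI impI)
  note int = integrable_fourier_integrand[OF H u]
  fix \<xi> :: "'a \<Rightarrow> complex" assume \<xi>: "\<xi> \<in> dual_group"
  show "cmod (fourier MG u \<xi>) \<le> (\<integral>x. norm (u x) \<partial>MG)"
    unfolding fourier_def using u \<xi> by (intro norm_integral_le) (auto simp: norm_mult dual_group_def)
  fix \<eta> :: "'a \<Rightarrow> complex" and d :: real
  assume \<eta>: "\<eta> \<in> dual_group" and d: "d > 0" "\<forall>x\<in>K. dist (\<xi> x) (\<eta> x) < d"
  have "dist (fourier MG u \<xi>) (fourier MG u \<eta>) = cmod (\<integral>x. cnj (\<xi> x) * u x - cnj (\<eta> x) * u x \<partial>MG)"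
    unfolding fourier_def dist_norm using int[OF \<xi>] int[OF \<eta>] by simp
  also have "\<dots> \<le> (\<integral>x. d * norm (u x) \<partial>MG)"
  proof (rule norm_integral_le)
    show "integrable MG (\<lambda>x. d * norm (u x))" using u by simp
    fix x
    show "cmod (cnj (\<xi> x) * u x - cnj (\<eta> x) * u x) \<le> d * norm (u x)"
    proof (cases "x \<in> K")
      case True
      then have "cmod (\<xi> x - \<eta> x) \<le> d" using d by (auto simp: dist_norm less_imp_le)
      then have "cmod (cnj (\<xi> x - \<eta> x)) * cmod (u x) \<le> d * cmod (u x)"
        by (intro mult_right_mono) (auto simp only: complex_mod_cnj norm_ge_zero)
      then show ?thesis by (simp add: norm_mult flip: left_diff_distrib)
    qed (use K in simp)
  qed
  finally show "dist (fourier MG u \<xi>) (fourier MG u \<eta>) \<le> (\<integral>x. norm (u x) \<partial>MG) * d"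
    by (simp add: mult.commute)
qed

lemma fourier_add_cmult:
  assumes "haar_measure euclidean op MG" "integrable MG u" "integrable MG v" "\<xi> \<in> dual_group"
  shows "fourier MG (\<lambda>x. u x + c * v x) \<xi> = fourier MG u \<xi> + c * fourier MG v \<xi>"
  using integrable_fourier_integrand[OF assms(1) _ assms(4)] assms(2,3)
  by (simp add: fourier_def algebra_simps)

text \<open>For functions supported in a compact set this follows from the Lipschitz estimate; a
  general \<open>f\<close> is truncated to compact sets, and the transforms of the truncations
  converge to that of \<open>f\<close>.\<close>

lemma fourier_measurable:
  assumes H: "haar_measure euclidean op MG" and HD: "haar_measure dual_topology op' MD"
    and f: "integrable MG f"
  shows "fourier MG f \<in> borel_measurable MD"
proof -
  have "\<exists>K. compact K \<and> K \<in> sets MG \<and>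
      (\<integral>x. indicator (space MG - K) x * norm (f x) \<partial>MG) < 1 / real (Suc n)" for n
    using integrable_compact_approx[OF H f, of "1 / real (Suc n)"] by (auto simp del: of_nat_Suc)
  then obtain K where K: "\<And>n. compact (K n)" "\<And>n. K n \<in> sets MG"
      "\<And>n. (\<integral>x. indicator (space MG - K n) x * norm (f x) \<partial>MG) < 1 / real (Suc n)" by metis
  define u where "u n x = indicator (K n) x *\<^sub>R f x" for n x
  have u: "integrable MG (u n)" for n
    unfolding u_def using integrable_mult_indicator[OF K(2) f] .
  have meas: "fourier MG (u n) \<in> borel_measurable MD" for n
    by (rule dual_lipschitz_measurable[OF HD K(1)[of n] dual_lipschitz_fourier[OF H u]])
       (simp add: u_def)
  show ?thesis
  proof (rule borel_measurable_LIMSEQ_metric[OF meas])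
    fix \<xi> assume "\<xi> \<in> space MD"
    then have \<xi>: "\<xi> \<in> dual_group" using space_dual[OF HD] by simp
    have "dist (fourier MG (u n) \<xi>) (fourier MG f \<xi>) \<le> 1 / real (Suc n)" for n
    proof -
      have "dist (fourier MG (u n) \<xi>) (fourier MG f \<xi>) = cmod (\<integral>x. cnj (\<xi> x) * u n x - cnj (\<xi> x) * f x \<partial>MG)"
        unfolding fourier_def dist_norm using integrable_fourier_integrand[OF H _ \<xi>] f u by simp
      \<comment> \<open>As \<open>\<xi>\<close> has modulus 1, the error is at most the mass of
        \<open>f\<close> outside \<open>K n\<close>.\<close>
      also have "\<dots> \<le> (\<integral>x. indicator (space MG - K n) x * norm (f x) \<partial>MG)"
      proof (rule norm_integral_le)
        show "integrable MG (\<lambda>x. indicator (space MG - K n) x * norm (f x))"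
          using integrable_mult_indicator[of "space MG - K n" MG "\<lambda>x. norm (f x)"] f K by auto
      qed (use \<xi> in \<open>auto simp: u_def dual_group_def norm_mult split: split_indicator\<close>)
      finally show ?thesis using K(3)[of n] by linarith
    qed
    moreover have "(\<lambda>n. 1 / real (Suc n)) \<longlonglongrightarrow> 0"
      using LIMSEQ_inverse_real_of_nat by (simp add: inverse_eq_divide)
    ultimately have "(\<lambda>n. dist (fourier MG (u n) \<xi>) (fourier MG f \<xi>)) \<longlonglongrightarrow> 0"
      by - (rule Lim_null_comparison[OF always_eventually, rotated], auto)
    then show "(\<lambda>n. fourier MG (u n) \<xi>) \<longlonglongrightarrow> fourier MG f \<xi>"
      by (rule tendsto_dist_iff[THEN iffD2])
  qed
qed

text \<open>\<open>plancherel_normalized\<close> equates nonnegative integrals; finiteness of the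
  one over the group and measurability of the transform turn this into integrability and an equation
  of Bochner integrals.\<close>

lemma plancherel_norm:
  assumes H: "haar_measure euclidean op MG" and HD: "haar_measure dual_topology op' MD"
    and P: "plancherel_normalized MG MD"
    and u: "integrable MG u" "square_integrable MG u"
  shows "square_integrable MD (fourier MG u)"
    and "(\<integral>\<xi>. (cmod (fourier MG u \<xi>))\<^sup>2 \<partial>MD) = (\<integral>x. (cmod (u x))\<^sup>2 \<partial>MG)"
proof -
  note m[measurable] = fourier_measurable[OF H HD u(1)]
  have eq: "(\<integral>\<^sup>+\<xi>. ennreal ((cmod (fourier MG u \<xi>))\<^sup>2) \<partial>MD) = (\<integral>\<^sup>+x. ennreal ((cmod (u x))\<^sup>2) \<partial>MG)"
    using P u by (auto simp: plancherel_normalized_def)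
  also have "\<dots> = ennreal (\<integral>x. (cmod (u x))\<^sup>2 \<partial>MG)"
    using u by (intro nn_integral_eq_integral) (auto simp: square_integrable_def)
  finally have *: "(\<integral>\<^sup>+\<xi>. ennreal ((cmod (fourier MG u \<xi>))\<^sup>2) \<partial>MD) = ennreal (\<integral>x. (cmod (u x))\<^sup>2 \<partial>MG)" .
  have "integrable MD (\<lambda>\<xi>. (cmod (fourier MG u \<xi>))\<^sup>2)"
    by (rule integrableI_nn_integral_finite[OF _ _ *]) auto
  then show "square_integrable MD (fourier MG u)" using m by (simp add: square_integrable_def)
  show "(\<integral>\<xi>. (cmod (fourier MG u \<xi>))\<^sup>2 \<partial>MD) = (\<integral>x. (cmod (u x))\<^sup>2 \<partial>MG)"
    using * by (subst integral_eq_nn_integral) auto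
qed

text \<open>Polarization on both sides: linearity of the transform respects each combination
  \<open>u + c v\<close>, and the isometry preserves its norm.\<close>

lemma plancherel_inner:
  assumes H: "haar_measure euclidean op MG" and HD: "haar_measure dual_topology op' MD"
    and P: "plancherel_normalized MG MD"
    and u: "integrable MG u" "square_integrable MG u"
    and v: "integrable MG v" "square_integrable MG v"
  shows "(\<integral>x. u x * cnj (v x) \<partial>MG) = (\<integral>\<xi>. fourier MG u \<xi> * cnj (fourier MG v \<xi>) \<partial>MD)"
proof -
  have "(\<integral>x. (cmod (u x + c * v x))\<^sup>2 \<partial>MG) = (\<integral>\<xi>. (cmod (fourier MG u \<xi> + c * fourier MG v \<xi>))\<^sup>2 \<partial>MD)" for c
  proof -
    have "(\<integral>x. (cmod (u x + c * v x))\<^sup>2 \<partial>MG) = (\<integral>\<xi>. (cmod (fourier MG (\<lambda>x. u x + c * v x) \<xi>))\<^sup>2 \<partial>MD)"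
      using u v square_integrable_add_cmult[OF u(2) v(2)]
      by (intro plancherel_norm(2)[OF H HD P, symmetric]) auto
    also have "\<dots> = (\<integral>\<xi>. (cmod (fourier MG u \<xi> + c * fourier MG v \<xi>))\<^sup>2 \<partial>MD)"
      using space_dual[OF HD] fourier_add_cmult[OF H u(1) v(1)]
      by (intro Bochner_Integration.integral_cong) auto
    finally show ?thesis .
  qed
  then have "4 * (\<integral>x. u x * cnj (v x) \<partial>MG) = 4 * (\<integral>\<xi>. fourier MG u \<xi> * cnj (fourier MG v \<xi>) \<partial>MD)"
    unfolding polarization[OF u(2) v(2)]
      polarization[OF plancherel_norm(1)[OF H HD P u] plancherel_norm(1)[OF H HD P v]] by (simp only:)
  then show ?thesis by simp
qed

text \<open>Both pairings are \<open>L^2\<close>-continuous along the approximants of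
  \<open>f\<close> while \<open>v\<close> stays fixed, so a transform known only as an
  \<open>L^2\<close> limit can be paired with one given by an integral.\<close>

lemma plancherel_transform_inner:
  assumes H: "haar_measure euclidean op MG" and HD: "haar_measure dual_topology op' MD"
    and P: "plancherel_normalized MG MD"
    and f: "square_integrable MG f" and g: "plancherel_transform MG MD f g"
    and v: "integrable MG v" "square_integrable MG v"
  shows "(\<integral>x. f x * cnj (v x) \<partial>MG) = (\<integral>\<xi>. g \<xi> * cnj (fourier MG v \<xi>) \<partial>MD)"
proof -
  obtain fs where fs: "\<And>n. integrable MG (fs n)" "\<And>n. square_integrable MG (fs n)"
    and l: "(\<lambda>n. \<integral>x. (cmod (fs n x - f x))\<^sup>2 \<partial>MG) \<longlonglongrightarrow> 0"
      "(\<lambda>n. \<integral>\<xi>. (cmod (fourier MG (fs n) \<xi> - g \<xi>))\<^sup>2 \<partial>MD) \<longlonglongrightarrow> 0"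
    using g unfolding plancherel_transform_def by blast
  have gs: "square_integrable MD g" using g by (simp add: plancherel_transform_def)
  have "(\<lambda>n. \<integral>x. fs n x * cnj (v x) \<partial>MG) \<longlonglongrightarrow> (\<integral>x. f x * cnj (v x) \<partial>MG)"
    by (rule L2_inner_tendsto[OF fs(2) f v(2) l(1)])
  moreover have "(\<lambda>n. \<integral>\<xi>. fourier MG (fs n) \<xi> * cnj (fourier MG v \<xi>) \<partial>MD) \<longlonglongrightarrow> (\<integral>\<xi>. g \<xi> * cnj (fourier MG v \<xi>) \<partial>MD)"
    by (rule L2_inner_tendsto[OF plancherel_norm(1)[OF H HD P fs] gs plancherel_norm(1)[OF H HD P v] l(2)])
  ultimately show ?thesis
    unfolding plancherel_inner[OF H HD P fs v] by (rule LIMSEQ_unique)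
qed

subsection \<open>Fourier synthesis\<close>

lemma complex_integrable_indicator:
  assumes "A \<in> sets M" "emeasure M A < \<infinity>"
  shows "integrable M (indicator A :: 'a \<Rightarrow> complex)"
proof -
  have "integrable M (\<lambda>x. complex_of_real (indicator A x))"
    using assms by (intro integrable_of_real integrable_real_indicator)
  moreover have "(\<lambda>x. complex_of_real (indicator A x)) = indicator A" by (auto simp: indicator_def)
  ultimately show ?thesis by simp
qed

text \<open>The inverse Fourier integral; it converges absolutely for integrable \<open>g\<close>,
  because characters have modulus 1.\<close>

definition fourier_synthesis :: "('a \<Rightarrow> complex) measure \<Rightarrow> (('a \<Rightarrow> complex) \<Rightarrow> complex) \<Rightarrow> 'a \<Rightarrow> complex" where
  "fourier_synthesis MD g x = (\<integral>\<xi>. g \<xi> * \<xi> x \<partial>MD)"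

lemma fourier_synthesis_bound:
  assumes HD: "haar_measure dual_topology op' MD" and g: "integrable MD g"
  shows "cmod (fourier_synthesis MD g x) \<le> (\<integral>\<xi>. cmod (g \<xi>) \<partial>MD)"
  unfolding fourier_synthesis_def
  using g space_dual[OF HD] by (intro norm_integral_le) (auto simp: norm_mult dual_group_def)

text \<open>Evaluations at the points of a compact neighbourhood \<open>K\<close> all satisfy
  \<open>dual_lipschitz K 1\<close>, so finite combinations of characters approximate the integral
  uniformly there, and a uniform limit of continuous functions is continuous.\<close>

lemma continuous_fourier_synthesis:
  fixes MD :: "('a::{topological_ab_group_add,t2_space} \<Rightarrow> complex) measure"
  assumes L: "locally_compact_group TYPE('a)" and HD: "haar_measure dual_topology op' MD"
    and g: "integrable MD g"
  shows "continuous_on UNIV (fourier_synthesis MD g)"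
proof (rule continuous_at_imp_continuous_on, rule ballI)
  fix x :: 'a
  obtain U K :: "'a set" where U: "open U" "compact K" "x \<in> U" "U \<subseteq> K"
    using L unfolding locally_compact_group_def by blast
  have "\<exists>P. continuous_on U P \<and> (\<forall>y\<in>U. dist (P y) (fourier_synthesis MD g y) \<le> 1 / real (Suc n))" for n
  proof -
    have pos: "1 / real (Suc n) > 0" by simp
    obtain N :: nat and \<xi> c where \<xi>: "\<And>i. i < N \<Longrightarrow> \<xi> i \<in> dual_group"
      and q: "\<And>T B. dual_lipschitz K B T \<Longrightarrow>
        cmod ((\<integral>\<zeta>. g \<zeta> * T \<zeta> \<partial>MD) - (\<Sum>i<N. c i * T (\<xi> i))) \<le> 1 / real (Suc n) * B"
      using dual_quadrature[OF HD U(2) g pos] by metis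
    have "continuous_on U (\<lambda>y. \<Sum>i<N. c i * \<xi> i y)"
      using \<xi> by (intro continuous_on_sum continuous_on_mult continuous_on_const)
        (auto simp: dual_group_def intro: continuous_on_subset)
    moreover have "dist (\<Sum>i<N. c i * \<xi> i y) (fourier_synthesis MD g y) \<le> 1 / real (Suc n)" if "y \<in> U" for y
      using q[OF dual_lipschitz_eval[of y K]] that U(4)
      by (auto simp: dist_norm norm_minus_commute fourier_synthesis_def)
    ultimately show ?thesis by blast
  qed
  then obtain P where P: "\<And>n. continuous_on U (P n)"
    "\<And>n y. y \<in> U \<Longrightarrow> dist (P n y) (fourier_synthesis MD g y) \<le> 1 / real (Suc n)"
    by metis
  have "uniform_limit U P (fourier_synthesis MD g) sequentially"
  proof (rule uniform_limitI)
    fix e :: real assume "e > 0"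
    then obtain n0 where n0: "1 / real (Suc n0) < e"
      using reals_Archimedean[of e] by (auto simp: inverse_eq_divide)
    show "\<forall>\<^sub>F n in sequentially. \<forall>y\<in>U. dist (P n y) (fourier_synthesis MD g y) < e"
    proof (rule eventually_sequentiallyI[of n0], rule ballI)
      fix n y assume "n0 \<le> n" "y \<in> U"
      moreover from \<open>n0 \<le> n\<close> have "1 / real (Suc n) \<le> 1 / real (Suc n0)"
        by (intro divide_left_mono) auto
      ultimately show "dist (P n y) (fourier_synthesis MD g y) < e"
        using P(2)[of y n] n0 by linarith
    qed
  qed
  then have "continuous_on U (fourier_synthesis MD g)"
    by (rule uniform_limit_theorem[rotated]) (use P(1) in auto)
  then show "isCont (fourier_synthesis MD g) x"
    using U continuous_on_eq_continuous_at by blast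
qed

lemma compact_in_sets_haar:
  fixes K :: "'a::{topological_ab_group_add,t2_space} set"
  assumes "haar_measure euclidean op MG" "compact K"
  shows "K \<in> sets MG" "emeasure MG K < \<infinity>"
  using assms borel_closed[OF compact_imp_closed[OF assms(2)]] sets_haar_euclidean[OF assms(1)]
  by (auto simp: haar_measure_def)

lemma fourier_synthesis_measurable:
  fixes MD :: "('a::{topological_ab_group_add,t2_space} \<Rightarrow> complex) measure"
  assumes "locally_compact_group TYPE('a)" "haar_measure euclidean op MG"
    "haar_measure dual_topology op' MD" "integrable MD g"
  shows "fourier_synthesis MD g \<in> borel_measurable MG"
  using borel_measurable_continuous_onI[OF continuous_fourier_synthesis[OF assms(1,3,4)]]
    measurable_cong_sets[OF sets_haar_euclidean[OF assms(2)] refl, of borel] by auto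

text \<open>Both sides differ from one finite sum \<open>S\<close> by at most \<open>e * m\<close>,
  where \<open>m\<close> is the measure of \<open>A\<close>: on the right quadrature applies to the
  conjugate transform of the indicator, on the left to evaluation at each point of
  \<open>A\<close>.\<close>

lemma set_integral_fourier_synthesis:
  fixes MD :: "('a::{topological_ab_group_add,t2_space} \<Rightarrow> complex) measure"
  assumes L: "locally_compact_group TYPE('a)"
    and H: "haar_measure euclidean op MG" and HD: "haar_measure dual_topology op' MD"
    and g: "integrable MD g" and K: "compact K" and A: "A \<in> sets MG" "A \<subseteq> K"
  shows "(\<integral>x. fourier_synthesis MD g x * indicator A x \<partial>MG) =
    (\<integral>\<xi>. g \<xi> * cnj (fourier MG (indicator A) \<xi>) \<partial>MD)" (is "?L = ?R")
proof -
  let ?h = "fourier_synthesis MD g"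
  have fin: "emeasure MG A < \<infinity>"
    using emeasure_mono[OF A(2) compact_in_sets_haar(1)[OF H K]] compact_in_sets_haar(2)[OF H K]
    by (rule le_less_trans)
  have iA: "integrable MG (indicator A :: 'a \<Rightarrow> complex)"
    using A(1) fin by (rule complex_integrable_indicator)
  have iAr: "integrable MG (indicator A :: 'a \<Rightarrow> real)"
    using A(1) fin by (rule integrable_real_indicator)
  define m where "m = (\<integral>x. indicator A x \<partial>MG :: real)"
  have n1: "norm (indicator A x :: complex) = indicator A x" for x by (simp add: indicator_def)
  have m: "(\<integral>x. norm (indicator A x :: complex) \<partial>MG) = m" "m \<ge> 0"
    unfolding m_def n1 by simp_all
  have bnd: "integrable MG (\<lambda>x. p x * indicator A x)"
    if p: "p \<in> borel_measurable MG" "\<And>x. cmod (p x) \<le> B" for p :: "'a \<Rightarrow> complex" and B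
  proof (rule Bochner_Integration.integrable_bound)
    show "integrable MG (\<lambda>x. B * indicator A x :: real)" using iAr by simp
    show "(\<lambda>x. p x * indicator A x) \<in> borel_measurable MG" using p(1) A(1) by simp
    show "AE x in MG. norm (p x * indicator A x) \<le> norm (B * indicator A x :: real)"
      using p(2) by (auto split: split_indicator intro: order_trans[OF _ abs_ge_self])
  qed
  have ih: "integrable MG (\<lambda>x. ?h x * indicator A x)"
    by (rule bnd[OF fourier_synthesis_measurable[OF L H HD g] fourier_synthesis_bound[OF HD g]])
  have i\<xi>: "integrable MG (\<lambda>x. \<xi> x * indicator A x)" if "\<xi> \<in> dual_group" for \<xi>
    by (rule bnd[OF dual_group_measurable[OF H that], of 1]) (use that in \<open>auto simp: dual_group_def\<close>)
  have "cmod (?L - ?R) \<le> e * (2 * m)" if e: "e > 0" for e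
  proof -
    obtain N :: nat and \<xi> c where \<xi>: "\<And>i. i < N \<Longrightarrow> \<xi> i \<in> dual_group"
      and q: "\<And>T B. dual_lipschitz K B T \<Longrightarrow>
        cmod ((\<integral>\<zeta>. g \<zeta> * T \<zeta> \<partial>MD) - (\<Sum>i<N. c i * T (\<xi> i))) \<le> e * B"
      using dual_quadrature[OF HD K g e] by metis
    define S where "S = (\<Sum>i<N. c i * cnj (fourier MG (indicator A) (\<xi> i)))"
    have "dual_lipschitz K m (\<lambda>\<xi>. cnj (fourier MG (indicator A) \<xi>))"
      using dual_lipschitz_cnj[OF dual_lipschitz_fourier[OF H iA, of K]] A(2) m(1)
      by (auto simp: indicator_def)
    then have R: "cmod (?R - S) \<le> e * m" using q unfolding S_def by blast
    \<comment> \<open>Rewritten as an integral over the group, \<open>S\<close> integrates the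
      quadrature sums of the synthesis over \<open>A\<close>.\<close>
    have "cnj (fourier MG (indicator A) (\<xi> i)) = (\<integral>x. \<xi> i x * indicator A x \<partial>MG)" for i
      unfolding fourier_def Bochner_Integration.integral_cnj[symmetric]
      by (intro Bochner_Integration.integral_cong) (auto simp: indicator_def)
    then have "S = (\<Sum>i<N. (\<integral>x. c i * (\<xi> i x * indicator A x) \<partial>MG))"
      unfolding S_def by (simp only: integral_mult_right_zero)
    also have "\<dots> = (\<integral>x. (\<Sum>i<N. c i * (\<xi> i x * indicator A x)) \<partial>MG)"
      using i\<xi> \<xi> by (intro Bochner_Integration.integral_sum[symmetric] integrable_mult_right) auto
    finally have S: "S = (\<integral>x. (\<Sum>i<N. c i * (\<xi> i x * indicator A x)) \<partial>MG)" .
    have "?L - S = (\<integral>x. ?h x * indicator A x - (\<Sum>i<N. c i * (\<xi> i x * indicator A x)) \<partial>MG)"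
      unfolding S using i\<xi> \<xi> ih
      by (intro Bochner_Integration.integral_diff[symmetric] Bochner_Integration.integrable_sum integrable_mult_right) auto
    also have "cmod \<dots> \<le> (\<integral>x. e * indicator A x \<partial>MG)"
    proof (rule norm_integral_le)
      show "integrable MG (\<lambda>x. e * indicator A x)" using iAr by simp
      fix x
      have "cmod (?h x - (\<Sum>i<N. c i * \<xi> i x)) \<le> e" if "x \<in> K"
        using q[OF dual_lipschitz_eval[OF that]] by (simp add: fourier_synthesis_def)
      then show "cmod (?h x * indicator A x - (\<Sum>i<N. c i * (\<xi> i x * indicator A x))) \<le> e * indicator A x"
        using A(2) by (cases "x \<in> A") auto
    qed
    also have "\<dots> = e * m" by (simp add: m_def)
    finally have "cmod (?L - S) \<le> e * m" .
    then have "cmod ((?L - S) - (?R - S)) \<le> e * m + e * m" using R norm_triangle_ineq4 add_mono order_trans by blast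
    then show ?thesis by simp
  qed
  note le = this
  have "cmod (?L - ?R) \<le> 0"
  proof (rule field_le_epsilon)
    fix d :: real assume d: "d > 0"
    \<comment> \<open>\<open>e = d / (2 * m + 1)\<close> keeps the total error at most
      \<open>d\<close> also when \<open>m = 0\<close>.\<close>
    then have "cmod (?L - ?R) \<le> d / (2 * m + 1) * (2 * m)" using m(2) by (intro le) simp
    also have "\<dots> \<le> 0 + d" using d m(2) by (simp add: field_simps)
    finally show "cmod (?L - ?R) \<le> 0 + d" .
  qed
  then show ?thesis by simp
qed

section \<open>From almost-everywhere equality on compact sets to the whole group\<close>

text \<open>By regularity \<open>A\<close> is covered up to a null set by countably many compact
  sets, each contributing a null exceptional set.\<close>

lemma AE_of_locally_AE:
  assumes H: "haar_measure X op M" and loc: "\<And>K. compactin X K \<Longrightarrow> AE x in M. x \<in> K \<longrightarrow> P x"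
    and A: "A \<in> sets M" "emeasure M A < \<infinity>"
  shows "AE x in M. x \<in> A \<longrightarrow> P x"
proof -
  obtain K :: "nat \<Rightarrow> 'a set" where K: "\<And>n. compactin X (K n)" and N: "A - (\<Union>n. K n) \<in> null_sets M"
    using finite_measure_sigma_compact[OF H A] by metis
  have "AE x in M. \<forall>n. x \<in> K n \<longrightarrow> P x"
    unfolding AE_all_countable using loc K by blast
  with AE_not_in[OF N] show ?thesis by eventually_elim auto
qed

text \<open>For a non-\<open>\<sigma>\<close>-finite measure a locally null set need not be null; continuity of \<open>h\<close> together
  with inner regularity on open sets forces \<open>{h \<noteq> 0}\<close> to be \<open>\<sigma>\<close>-finite.\<close>
lemma AE_eq_of_locally_AE_eq:
  assumes H: "haar_measure euclidean op M" and f: "square_integrable M f"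
    and h: "continuous_on UNIV h"
    and loc: "\<And>K. compact K \<Longrightarrow> AE x in M. x \<in> K \<longrightarrow> f x = h x"
  shows "AE x in M. f x = (h x :: complex)"
proof -
  have locK: "AE x in M. x \<in> K \<longrightarrow> f x = h x" if "compactin euclidean K" for K
    using loc that by simp
  have [measurable]: "f \<in> borel_measurable M" using f by (simp add: square_integrable_def)
  have fi: "integrable M (\<lambda>x. (cmod (f x))\<^sup>2)" using f by (simp add: square_integrable_def)
  define I where "I = (\<integral>\<^sup>+x. ennreal ((cmod (f x))\<^sup>2) \<partial>M)"
  have I: "I < \<infinity>" unfolding I_def using fi by (simp add: nn_integral_eq_integral)
  \<comment> \<open>By continuity of \<open>h\<close> these sets are open, so inner regularity
    applies to them; together they make up \<open>{h \<noteq> 0}\<close>.\<close>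
  define E where "E n = {x. cmod (h x) > 1 / real (Suc n)}" for n
  have Eo: "openin euclidean (E n)" for n
    unfolding E_def open_openin[symmetric]
    by (intro open_Collect_less continuous_intros h)
  have Ef: "emeasure M (E n) < \<infinity>" for n
  proof -
    \<comment> \<open>Chebyshev's inequality: on \<open>K\<close> almost everywhere
      \<open>|f| = |h| > 1 / (n + 1)\<close>. The bound does not depend on \<open>K\<close>, so it
      passes to the supremum.\<close>
    have "emeasure M K \<le> ennreal ((real (Suc n))\<^sup>2) * I" if K: "compact K" "K \<subseteq> E n" for K
    proof (cases "K \<in> sets M")
      case True
      have "emeasure M K = (\<integral>\<^sup>+x. indicator K x \<partial>M)" using True by simp
      also have "\<dots> \<le> (\<integral>\<^sup>+x. ennreal ((real (Suc n))\<^sup>2) * ennreal ((cmod (f x))\<^sup>2) \<partial>M)"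
      proof (rule nn_integral_mono_AE)
        show "AE x in M. indicator K x \<le> ennreal ((real (Suc n))\<^sup>2) * ennreal ((cmod (f x))\<^sup>2)"
          using loc[OF K(1)]
        proof eventually_elim
          case (elim x)
          show ?case
          proof (cases "x \<in> K")
            case True
            then have "1 / real (Suc n) < cmod (f x)" using elim K(2) by (auto simp: E_def)
            then have "1 \<le> real (Suc n) * cmod (f x)" by (simp add: field_simps)
            then have "1 \<le> (real (Suc n) * cmod (f x))\<^sup>2" by (rule one_le_power)
            then have "1 \<le> ennreal ((real (Suc n))\<^sup>2 * (cmod (f x))\<^sup>2)"
              by (simp add: power_mult_distrib del: of_nat_Suc)
            then show ?thesis using True by (simp add: ennreal_mult del: of_nat_Suc)
          qed simp
        qed
      qed
      also have "\<dots> = ennreal ((real (Suc n))\<^sup>2) * I"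
        unfolding I_def by (rule nn_integral_cmult) measurable
      finally show ?thesis .
    qed (simp add: emeasure_notin_sets)
    then have "(SUP K\<in>{K. compactin euclidean K \<and> K \<subseteq> E n}. emeasure M K) \<le> ennreal ((real (Suc n))\<^sup>2) * I"
      by (intro SUP_least) auto
    also have "\<dots> < \<infinity>" using I by (simp add: ennreal_mult_less_top del: of_nat_Suc)
    finally show ?thesis using H Eo unfolding haar_measure_def by metis
  qed
  obtain F :: "nat \<Rightarrow> _ set" where F: "\<And>n. F n \<in> sets M" "\<And>n. emeasure M (F n) < \<infinity>"
    "{x \<in> space M. (cmod (f x))\<^sup>2 \<noteq> 0} = (\<Union>n. F n)"
    using integrable_support_sigma_finite[OF fi] by metis
  have "AE x in M. \<forall>n. x \<in> F n \<longrightarrow> f x = h x"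
    unfolding AE_all_countable using AE_of_locally_AE[OF H locK F(1,2)] by blast
  moreover have "AE x in M. \<forall>n. x \<in> E n \<longrightarrow> f x = h x"
    unfolding AE_all_countable using AE_of_locally_AE[OF H locK openin_in_sets[OF H Eo] Ef] by blast
  moreover have "AE x in M. x \<in> space M" by simp
  \<comment> \<open>The \<open>F n\<close> cover \<open>{f \<noteq> 0}\<close> and the
    \<open>E n\<close> cover \<open>{h \<noteq> 0}\<close>; outside both families the two functions
    vanish.\<close>
  ultimately show ?thesis
  proof eventually_elim
    case (elim x)
    show ?case
    proof (rule ccontr)
      assume ne: "f x \<noteq> h x"
      then have "f x = 0" using elim F(3) by auto
      with ne have "0 < cmod (h x)" by auto
      then obtain n where "1 / real (Suc n) < cmod (h x)"
        using reals_Archimedean[of "cmod (h x)"] by (auto simp: inverse_eq_divide)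
      with elim ne show False by (auto simp: E_def)
    qed
  qed
qed

text \<open>The Plancherel pairing with an indicator and the exchange of integrals share their
  right-hand side, so both functions have equal integrals over all Borel subsets of a compact
  \<open>K\<close> and agree almost everywhere on \<open>K\<close>.\<close>

lemma AE_eq_fourier_synthesis:
  fixes MD :: "('a::{topological_ab_group_add,t2_space} \<Rightarrow> complex) measure"
  assumes L: "locally_compact_group TYPE('a)"
    and H: "haar_measure euclidean op MG" and HD: "haar_measure dual_topology op' MD"
    and P: "plancherel_normalized MG MD"
    and f: "square_integrable MG f" and fg: "plancherel_transform MG MD f g"
    and g: "integrable MD g"
  shows "AE x in MG. f x = fourier_synthesis MD g x"
proof (rule AE_eq_of_locally_AE_eq[OF H f continuous_fourier_synthesis[OF L HD g]])
  fix K :: "'a set" assume K: "compact K"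
  let ?h = "fourier_synthesis MD g"
  note Ks = compact_in_sets_haar[OF H K]
  have iA: "integrable MG (indicator A :: 'a \<Rightarrow> complex)" "square_integrable MG (indicator A :: 'a \<Rightarrow> complex)"
    if A: "A \<in> sets MG" "A \<subseteq> K" for A
  proof -
    have fin: "emeasure MG A < \<infinity>"
      using emeasure_mono[OF A(2) Ks(1)] Ks(2) by (rule le_less_trans)
    show "integrable MG (indicator A :: 'a \<Rightarrow> complex)" using A(1) fin by (rule complex_integrable_indicator)
    have "(\<lambda>x. (cmod (indicator A x))\<^sup>2) = (indicator A :: 'a \<Rightarrow> real)" by (auto simp: indicator_def)
    then show "square_integrable MG (indicator A :: 'a \<Rightarrow> complex)"
      using A(1) fin by (simp add: square_integrable_def)
  qed
  have eq: "(\<integral>x. f x * indicator A x \<partial>MG) = (\<integral>x. ?h x * indicator A x \<partial>MG)"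
    if A: "A \<in> sets MG" "A \<subseteq> K" for A
  proof -
    have "(\<lambda>x. cnj (indicator A x)) = (indicator A :: 'a \<Rightarrow> complex)" by (auto simp: indicator_def)
    then show ?thesis
      using plancherel_transform_inner[OF H HD P f fg iA[OF A]]
      unfolding set_integral_fourier_synthesis[OF L H HD g K A] by (metis (no_types, lifting) Bochner_Integration.integral_cong)
  qed
  have fK: "integrable MG (\<lambda>x. f x * indicator K x)"
    by (rule L2_Cauchy_Schwarz(1)[OF f iA(2)[OF Ks(1) subset_refl]])
  have hK: "integrable MG (\<lambda>x. ?h x * indicator K x)"
  proof (rule Bochner_Integration.integrable_bound)
    show "integrable MG (\<lambda>x. complex_of_real (\<integral>\<xi>. cmod (g \<xi>) \<partial>MD) * indicator K x)"
      using iA(1)[OF Ks(1) subset_refl] by simp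
    show "(\<lambda>x. ?h x * indicator K x) \<in> borel_measurable MG"
      using fourier_synthesis_measurable[OF L H HD g] Ks(1) by simp
    show "AE x in MG. cmod (?h x * indicator K x) \<le> cmod (complex_of_real (\<integral>\<xi>. cmod (g \<xi>) \<partial>MD) * indicator K x)"
      using fourier_synthesis_bound[OF HD g] by (auto simp: indicator_def)
  qed
  \<comment> \<open>After multiplication with the indicator of \<open>K\<close>, integrals over
    arbitrary measurable \<open>A\<close> reduce to the subsets \<open>A \<inter> K\<close>.\<close>
  have s: "(\<integral>x\<in>A. p x * indicator K x \<partial>MG) = (\<integral>x. p x * indicator (A \<inter> K) x \<partial>MG)" for A and p :: "'a \<Rightarrow> complex"
    unfolding set_lebesgue_integral_def by (intro Bochner_Integration.integral_cong) (auto simp: indicator_def)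
  have sR: "(\<integral>x\<in>A. Re (p x * indicator K x) \<partial>MG) = Re (\<integral>x\<in>A. p x * indicator K x \<partial>MG)"
      "(\<integral>x\<in>A. Im (p x * indicator K x) \<partial>MG) = Im (\<integral>x\<in>A. p x * indicator K x \<partial>MG)"
    if "A \<in> sets MG" "integrable MG (\<lambda>x. p x * indicator K x)" for A and p :: "'a \<Rightarrow> complex"
    using integral_Re[OF integrable_mult_indicator[OF that]] integral_Im[OF integrable_mult_indicator[OF that]]
    unfolding set_lebesgue_integral_def by simp_all
  have e: "(\<integral>x\<in>A. f x * indicator K x \<partial>MG) = (\<integral>x\<in>A. ?h x * indicator K x \<partial>MG)" if "A \<in> sets MG" for A
    unfolding s using that Ks(1) by (intro eq) auto
  \<comment> \<open>\<open>density_unique_real\<close> compares real functions, hence the split into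
    real and imaginary parts.\<close>
  have "AE x in MG. Re (f x * indicator K x) = Re (?h x * indicator K x)"
    using sR(1)[OF _ fK] sR(1)[OF _ hK] e by (intro density_unique_real integrable_Re fK hK) auto
  moreover have "AE x in MG. Im (f x * indicator K x) = Im (?h x * indicator K x)"
    using sR(2)[OF _ fK] sR(2)[OF _ hK] e by (intro density_unique_real integrable_Im fK hK) auto
  ultimately show "AE x in MG. x \<in> K \<longrightarrow> f x = ?h x"
    by eventually_elim (auto simp: complex_eq_iff)
qed

section \<open>Sobolev norm and the embedding\<close>

text \<open>Cauchy--Schwarz for \<open>g = u * v\<close>, where \<open>|u|^2\<close> is the
  integrable weight and \<open>|v|^2\<close> the integrand of the Sobolev norm.\<close>

lemma Hs_norm_dominates_L1:
  assumes w: "integrable MD (\<lambda>\<xi>. (1 + (\<gamma> \<xi>)\<^sup>2) powr (- s))" and g: "square_integrable MD g"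
    and fin: "Hs_norm_sq MD \<gamma> s g < \<infinity>"
  shows "integrable MD g"
    and "(\<integral>\<xi>. cmod (g \<xi>) \<partial>MD) \<le> sqrt (\<integral>\<xi>. (1 + (\<gamma> \<xi>)\<^sup>2) powr (- s) \<partial>MD) * sqrt (enn2real (Hs_norm_sq MD \<gamma> s g))"
proof -
  define p where "p \<xi> = (1 + (\<gamma> \<xi>)\<^sup>2) powr (- s)" for \<xi>
  have pos: "p \<xi> > 0" for \<xi> 
    using add_pos_nonneg[OF zero_less_one zero_le_power2[of "\<gamma> \<xi>"]] by (simp add: p_def)
  \<comment> \<open>All weights are written through \<open>p\<close>, which is measurable because it
    is integrable; measurability of \<open>\<gamma>\<close> itself is not among the
    assumptions.\<close>
  have inv: "(1 + (\<gamma> \<xi>)\<^sup>2) powr s = 1 / p \<xi>" for \<xi> unfolding p_def by (simp add: powr_minus_divide)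
  have [measurable]: "p \<in> borel_measurable MD" "g \<in> borel_measurable MD"
    using w g borel_measurable_integrable unfolding p_def[abs_def] square_integrable_def by auto
  define u v where "u \<xi> = complex_of_real (sqrt (p \<xi>))" and "v \<xi> = g \<xi> / complex_of_real (sqrt (p \<xi>))" for \<xi>
  have uv: "u \<xi> * v \<xi> = g \<xi>" for \<xi> using pos[of \<xi>] by (simp add: u_def v_def)
  have u2: "(cmod (u \<xi>))\<^sup>2 = p \<xi>" for \<xi> using pos[of \<xi>] by (simp add: u_def)
  have v2: "(cmod (v \<xi>))\<^sup>2 = (1 + (\<gamma> \<xi>)\<^sup>2) powr s * (cmod (g \<xi>))\<^sup>2" for \<xi>
    using pos[of \<xi>] by (simp add: v_def inv norm_divide power_divide)
  have [measurable]: "u \<in> borel_measurable MD" "v \<in> borel_measurable MD"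
    unfolding u_def[abs_def] v_def[abs_def] by measurable
  have n: "(\<integral>\<^sup>+\<xi>. ennreal ((cmod (v \<xi>))\<^sup>2) \<partial>MD) = Hs_norm_sq MD \<gamma> s g"
    by (simp add: v2 Hs_norm_sq_def)
  have su: "square_integrable MD u"
    using w by (simp add: square_integrable_def u2 p_def[abs_def])
  have sv: "square_integrable MD v"
    unfolding square_integrable_def using n fin by (auto intro!: integrableI_bounded)
  show "integrable MD g" using L2_Cauchy_Schwarz(1)[OF su sv] by (simp add: uv)
  have "(\<integral>\<xi>. (cmod (v \<xi>))\<^sup>2 \<partial>MD) = enn2real (Hs_norm_sq MD \<gamma> s g)"
    unfolding n[symmetric] by (rule integral_eq_nn_integral) auto
  then show "(\<integral>\<xi>. cmod (g \<xi>) \<partial>MD) \<le> sqrt (\<integral>\<xi>. (1 + (\<gamma> \<xi>)\<^sup>2) powr (- s) \<partial>MD) * sqrt (enn2real (Hs_norm_sq MD \<gamma> s g))"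
    using L2_Cauchy_Schwarz(3)[OF su sv] by (simp add: uv u2 p_def)
qed

theorem theorem1:
  fixes MG :: "'a::{topological_ab_group_add,t2_space} measure"
    and MD :: "('a \<Rightarrow> complex) measure"
    and \<gamma> :: "('a \<Rightarrow> complex) \<Rightarrow> real"
    and s :: real
  assumes "locally_compact_group TYPE('a)"
    and "haar_measure euclidean (+) MG"
    and "haar_measure dual_topology dual_mult MD"
    and "plancherel_normalized MG MD"
    and "\<gamma> \<in> Gamma_class"
    and "s \<ge> 0"
    and "integrable MD (\<lambda>\<xi>. (1 + (\<gamma> \<xi>)\<^sup>2) powr (- s))"
  shows "\<exists>C. \<forall>f g. square_integrable MG f \<longrightarrow> plancherel_transform MG MD f g \<longrightarrow>
           Hs_norm_sq MD \<gamma> s g < \<infinity> \<longrightarrow>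
           (\<exists>h. continuous_on UNIV h \<and> (AE x in MG. f x = h x) \<and>
                (\<forall>x. cmod (h x) \<le> C * sqrt (enn2real (Hs_norm_sq MD \<gamma> s g))))"
proof (intro exI allI impI)
  fix f g
  assume f: "square_integrable MG f" and fg: "plancherel_transform MG MD f g"
    and fin: "Hs_norm_sq MD \<gamma> s g < \<infinity>"
  have "square_integrable MD g" using fg by (simp add: plancherel_transform_def)
  note g = Hs_norm_dominates_L1[OF assms(7) this fin]
  \<comment> \<open>The constant is the square root of the integral of the weight
    \<open>(1 + (\<gamma> \<xi>)\<^sup>2) powr (- s)\<close>, hence independent of \<open>f\<close>
    and \<open>g\<close>.\<close>
  show "continuous_on UNIV (fourier_synthesis MD g) \<and> (AE x in MG. f x = fourier_synthesis MD g x) \<and>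
      (\<forall>x. cmod (fourier_synthesis MD g x)
        \<le> sqrt (\<integral>\<xi>. (1 + (\<gamma> \<xi>)\<^sup>2) powr (- s) \<partial>MD) * sqrt (enn2real (Hs_norm_sq MD \<gamma> s g)))"
    using continuous_fourier_synthesis[OF assms(1,3) g(1)]
      AE_eq_fourier_synthesis[OF assms(1-4) f fg g(1)]
      order_trans[OF fourier_synthesis_bound[OF assms(3) g(1)] g(2)] by blast
qed

end
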